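(* Let $k,a$ be positive integers and let $(G_{k,n})_{n\ge 0}$ be the Generalized $k$-Pell sequence with $G_{k,0}=G_{k,1}=a$. Then for every positive integer $r$ and every integer $n\ge r$, \[G_{k,n-r}G_{k,n+r}-G_{k,n}^2=(-k)^{n-r}\left(G_{k,r}^2-a^2(-k)^r\right).\]
   Context: For positive integers $k,a$, the Generalized $k$-Pell sequence $(G_{k,n})_{n\ge 0}$ is the integer sequence defined by $G_{k,0}=G_{k,1}=a$ and $G_{k,n}=2G_{k,n-1}+kG_{k,n-2}$ for $n\ge 2$. *)

theory Defs imports Main
begin

fun gen_pell :: "int \<Rightarrow> int \<Rightarrow> nat \<Rightarrow> int" where
  "gen_pell k a 0 = a"
| "gen_pell k a (Suc 0) = a"
| "gen_pell k a (Suc (Suc n)) = 2 * gen_pell k a (Suc n) + k * gen_pell k a n"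

end

theory Submission imports Defs
begin

text \<open>With \<open>\<alpha>, \<beta>\<close> the roots of \<open>x\<^sup>2 = 2 x + k\<close>, the sequence is
  \<open>G\<^sub>n = a (\<alpha>\<^sup>n + \<beta>\<^sup>n) / 2\<close>: it is \<open>a / 2\<close> times the companion Lucas sequence, because the
  initial values satisfy \<open>G\<^sub>1 = G\<^sub>0 (\<alpha> + \<beta>) / 2\<close>. Since \<open>\<alpha> \<beta> = - k\<close>, multiplying out two such
  power sums turns a product of two terms into a sum,
  \<open>2 G\<^bsub>m+d\<^esub> G\<^sub>m = a (G\<^bsub>2m+d\<^esub> + (-k)\<^sup>m G\<^sub>d)\<close>
  (lemma \<open>gen_pell_product_to_sum\<close>, proved from the recurrence to stay within the integers).

  Applied to twice each product on the left-hand side of the identity, with \<open>m = n - r\<close>, this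
  formula yields the same top term \<open>a G\<^bsub>2n\<^esub>\<close>, which cancels. So twice the left-hand side is
  \<open>(-k)\<^sup>m\<close> times \<open>a G\<^bsub>2r\<^esub> - a\<^sup>2 (-k)\<^sup>r\<close>, and the formula for the square of \<open>G\<^sub>r\<close>
  rewrites \<open>a G\<^bsub>2r\<^esub>\<close> as \<open>2 G\<^sub>r\<^sup>2 - a\<^sup>2 (-k)\<^sup>r\<close>.\<close>

text \<open>The analogue of \<open>2 cos x cos y = cos (x + y) + cos (x - y)\<close>. For fixed total index
  \<open>m + d\<close> both sides satisfy the recurrence in \<open>m\<close>; the induction step therefore uses the two
  preceding instances at offsets \<open>d + 1\<close> and \<open>d + 2\<close>.\<close>

lemma gen_pell_product_to_sum:
  "2 * gen_pell k a (m + d) * gen_pell k a m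
     = a * (gen_pell k a (2 * m + d) + (- k) ^ m * gen_pell k a d)"
proof (induction m arbitrary: d rule: induct_nat_012)
  case 0
  show ?case by simp
next
  case 1
  show ?case by (simp add: algebra_simps)
next
  case (ge2 m)
  let ?G = "gen_pell k a"
  have IH0: "2 * ?G (Suc (Suc (m + d))) * ?G m
      = a * (?G (Suc (Suc (2 * m + d))) + (- k) ^ m * ?G (Suc (Suc d)))"
    using ge2(1)[of "Suc (Suc d)"] by (simp del: gen_pell.simps)
  have IH1: "2 * ?G (Suc (Suc (m + d))) * ?G (Suc m)
      = a * (?G (Suc (Suc (Suc (2 * m + d)))) - k * (- k) ^ m * ?G (Suc d))"
    using ge2(2)[of "Suc d"] by (simp del: gen_pell.simps)
  have "2 * ?G (Suc (Suc (m + d))) * ?G (Suc (Suc m))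
      = 2 * (2 * ?G (Suc (Suc (m + d))) * ?G (Suc m)) + k * (2 * ?G (Suc (Suc (m + d))) * ?G m)"
    unfolding gen_pell.simps(3)[of k a m] by algebra
  also have "\<dots> = a * ((2 * ?G (Suc (Suc (Suc (2 * m + d)))) + k * ?G (Suc (Suc (2 * m + d))))
      + k * (- k) ^ m * (?G (Suc (Suc d)) - 2 * ?G (Suc d)))"
    unfolding IH0 IH1 by algebra
  also have "\<dots> = a * (?G (Suc (Suc (Suc (Suc (2 * m + d))))) + (- k) ^ Suc (Suc m) * ?G d)"
    by simp
  finally show ?case by (simp del: gen_pell.simps)
qed

theorem theorem2p4:
  fixes k a :: int and n r :: nat
  assumes "k > 0" and "a > 0" and "r > 0" and "n \<ge> r"
  shows "gen_pell k a (n - r) * gen_pell k a (n + r) - (gen_pell k a n)^2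
           = (- k) ^ (n - r) * ((gen_pell k a r)^2 - a^2 * (- k) ^ r)"
proof -
  let ?G = "gen_pell k a"
  obtain m where n: "n = m + r"
    using \<open>n \<ge> r\<close> le_iff_add by (metis add.commute)
  have outer: "2 * ?G (m + 2 * r) * ?G m = a * (?G (2 * m + 2 * r) + (- k) ^ m * ?G (2 * r))"
    by (rule gen_pell_product_to_sum)
  have middle: "2 * ?G (m + r) ^ 2 = a * (?G (2 * m + 2 * r) + (- k) ^ m * (- k) ^ r * a)"
    using gen_pell_product_to_sum[of k a "m + r" 0]
    by (simp add: power2_eq_square power_add algebra_simps)
  have double: "2 * ?G r ^ 2 = a * (?G (2 * r) + (- k) ^ r * a)"
    using gen_pell_product_to_sum[of k a r 0] by (simp add: power2_eq_square)
  have "2 * (?G m * ?G (m + 2 * r) - ?G (m + r) ^ 2)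
      = 2 * ?G (m + 2 * r) * ?G m - 2 * ?G (m + r) ^ 2"
    by (simp add: algebra_simps)
  also have "\<dots> = (- k) ^ m * (a * (?G (2 * r) + (- k) ^ r * a) - 2 * a ^ 2 * (- k) ^ r)"
    unfolding outer middle by (simp add: algebra_simps power2_eq_square)
  also have "\<dots> = 2 * ((- k) ^ m * (?G r ^ 2 - a ^ 2 * (- k) ^ r))"
    unfolding double[symmetric] by (simp add: algebra_simps)
  finally have "?G m * ?G (m + 2 * r) - ?G (m + r) ^ 2
      = (- k) ^ m * (?G r ^ 2 - a ^ 2 * (- k) ^ r)"
    by (simp only: mult_cancel_left) simp
  moreover have "n - r = m" "n + r = m + 2 * r"
    using n by simp_all
  ultimately show ?thesis
    by (simp only: n)
qed

end
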